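(* Let $0\leq m\leq d$. The maps $i_1,i_2:S\rightarrow P^*(S)$ defined by $i_1(u)=\{x\}$ with $x(t)=\bigcap_{\xi\in[t-d,t-d+m]}u(\xi)$, and $i_2(u)=\{x\}$ with $x(t)=\bigcup_{\xi\in[t-d,t-d+m]}u(\xi)$, are deterministic, time invariant, constant delay conditions.
   Context: $\mathbf{B}=\{0,1\}$ with order $0\leq1$ and Boolean laws complement $\overline{\,\cdot\,}$, AND $\cdot$, OR, XOR, extended pointwise to functions. For $x:\mathbf{R}\rightarrow\mathbf{B}$ and $A\subset\mathbf{R}$, $\bigcap_{\xi\in A}x(\xi)$ is $0$ if some $\xi\in A$ has $x(\xi)=0$ and $1$ otherwise; $\bigcup_{\xi\in A}x(\xi)$ is $1$ if some $\xi\in A$ has $x(\xi)=1$ and $0$ otherwise. A signal is a function $x:\mathbf{R}\rightarrow\mathbf{B}$ for which there exists an unbounded sequence $0\leq t_0<t_1<t_2<\dots$ of reals such that $x$ is constant on $(-\infty,t_0)$ and on each interval $[t_k,t_{k+1})$. $S$ is the set of signals, $P^*(S)$ the set of non-empty subsets of $S$, and $\tau^d(t)=t-d$. For a signal $x$, $x(t-0)$ denotes the left limit: for each $t$ there is $\varepsilon>0$ with $x(\xi)=x(t-0)$ for $\xi\in(t-\varepsilon,t)$. For $u,x\in S$, $(u,x)$ satisfies the stability condition (SC) if for every $a\in\mathbf{B}$: if $u(t)=a$ for all sufficiently large $t$, then $x(t)=a$ for all sufficiently large $t$; $Sol_{SC}(u)=\{x\in S\mid(u,x)\text{ satisfies SC}\}$.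 A delay condition (DC) is a function $i:S\rightarrow P^*(S)$ with $i(u)\subset Sol_{SC}(u)$ for all $u$. A DC $i$ is deterministic if each $i(u)$ has exactly one element. A DC $i$ is time invariant if for all $u\in S$, all $x$ and all $d\in\mathbf{R}$: if $u\circ\tau^d\in S$ and $x\in i(u)$ then $x\circ\tau^d\in S$ and $x\circ\tau^d\in i(u\circ\tau^d)$. A DC $i$ is constant if there exist $d_r\geq0$, $d_f\geq0$ such that for all $u\in S$, all $x\in i(u)$ and all $t\in\mathbf{R}$: $\overline{x(t-0)}\cdot x(t)\leq u(t-d_r)$ and $x(t-0)\cdot\overline{x(t)}\leq\overline{u(t-d_f)}$. *)

theory Defs
  imports "HOL-Analysis.Analysis"
begin

text \<open>
  The Boolean algebra $\mathbf{B}$ is the library type \<^typ>\<open>bool\<close>, ordered by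
  \<^prop>\<open>False \<le> True\<close>. Intersections and unions of Boolean functions are its complete-lattice
  operations \<^const>\<open>Inf\<close> and \<^const>\<open>Sup\<close>.
\<close>

definition signals :: "(real \<Rightarrow> bool) set" where
  "signals = {x. \<exists>t :: nat \<Rightarrow> real. 0 \<le> t 0 \<and> strict_mono t \<and> \<not> bdd_above (range t) \<and>
     x constant_on {..<t 0} \<and> (\<forall>k. x constant_on {t k..<t (Suc k)})}"

definition shift :: "real \<Rightarrow> real \<Rightarrow> real" where
  "shift d t = t - d"

text \<open>The left limit $x(t-0)$; it exists and is unique at every \<open>t\<close> if \<open>x\<close> is a signal, and is
  only used for signals.\<close>

definition left_limit :: "(real \<Rightarrow> bool) \<Rightarrow> real \<Rightarrow> bool" where
  "left_limit x t = (THE b. \<exists>\<epsilon>>0. \<forall>\<xi>\<in>{t - \<epsilon><..<t}. x \<xi> = b)"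

definition stability_condition :: "(real \<Rightarrow> bool) \<Rightarrow> (real \<Rightarrow> bool) \<Rightarrow> bool" where
  "stability_condition u x \<longleftrightarrow>
     (\<forall>a. (\<forall>\<^sub>F t in at_top. u t = a) \<longrightarrow> (\<forall>\<^sub>F t in at_top. x t = a))"

definition Sol_SC :: "(real \<Rightarrow> bool) \<Rightarrow> (real \<Rightarrow> bool) set" where
  "Sol_SC u = {x \<in> signals. stability_condition u x}"

text \<open>Maps with domain \<^const>\<open>signals\<close> are total functions whose values outside
  \<^const>\<open>signals\<close> are irrelevant: every notion below only inspects arguments in
  \<^const>\<open>signals\<close>.\<close>

definition delay_condition :: "((real \<Rightarrow> bool) \<Rightarrow> (real \<Rightarrow> bool) set) \<Rightarrow> bool" where
  "delay_condition i \<longleftrightarrow>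
     i \<in> signals \<rightarrow> Pow signals - {{}} \<and> (\<forall>u\<in>signals. i u \<subseteq> Sol_SC u)"

definition deterministic :: "((real \<Rightarrow> bool) \<Rightarrow> (real \<Rightarrow> bool) set) \<Rightarrow> bool" where
  "deterministic i \<longleftrightarrow> (\<forall>u\<in>signals. \<exists>!x. x \<in> i u)"

definition time_invariant :: "((real \<Rightarrow> bool) \<Rightarrow> (real \<Rightarrow> bool) set) \<Rightarrow> bool" where
  "time_invariant i \<longleftrightarrow>
     (\<forall>u\<in>signals. \<forall>x d. u \<circ> shift d \<in> signals \<and> x \<in> i u \<longrightarrow>
        x \<circ> shift d \<in> signals \<and> x \<circ> shift d \<in> i (u \<circ> shift d))"

definition constant_delay :: "((real \<Rightarrow> bool) \<Rightarrow> (real \<Rightarrow> bool) set) \<Rightarrow> bool" where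
  "constant_delay i \<longleftrightarrow>
     (\<exists>d\<^sub>r\<ge>0. \<exists>d\<^sub>f\<ge>0. \<forall>u\<in>signals. \<forall>x\<in>i u. \<forall>t.
        (\<not> left_limit x t \<and> x t) \<le> u (t - d\<^sub>r) \<and>
        (left_limit x t \<and> \<not> x t) \<le> (\<not> u (t - d\<^sub>f)))"

definition delay_Inf :: "real \<Rightarrow> real \<Rightarrow> (real \<Rightarrow> bool) \<Rightarrow> (real \<Rightarrow> bool) set" where
  "delay_Inf m d u = {\<lambda>t. INF \<xi>\<in>{t - d..t - d + m}. u \<xi>}"

definition delay_Sup :: "real \<Rightarrow> real \<Rightarrow> (real \<Rightarrow> bool) \<Rightarrow> (real \<Rightarrow> bool) set" where
  "delay_Sup m d u = {\<lambda>t. SUP \<xi>\<in>{t - d..t - d + m}. u \<xi>}"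

end

theory Submission
  imports Defs
begin

text \<open>
  The windows at \<open>a < b\<close> have the same image under \<open>u\<close> as soon as \<open>u\<close> does not switch in
  \<open>{a - d<..b - d}\<close> and \<open>{a - d + m<..b - d + m}\<close>. Hence every function of that image switches
  only at translates, by \<open>d\<close> and by \<open>d - m\<close>, of the switching times of \<open>u\<close>, and is a signal.
  An output of \<open>delay_Inf\<close> rises only if the whole closed window is \<open>1\<close>, in particular its left
  end point (delay \<open>d\<close>); just before a fall every point of the window but the right end point
  was already covered by a window with value \<open>1\<close>, so the right end point (delay \<open>d - m\<close>) must be
  \<open>0\<close>. For \<open>delay_Sup\<close> the roles of the two end points are exchanged.
\<close>

text \<open>Only finitely many elements lie below a given one, so least elements and immediate
  successors exist and can be followed upwards. This turns a switching set into a sequence as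
  required by \<open>signals\<close>.\<close>

lemma locally_finite_enumeration:
  fixes T :: "real set"
  assumes "T \<noteq> {}" and "\<not> bdd_above T" and fin: "\<And>a. finite (T \<inter> {..a})"
  obtains t :: "nat \<Rightarrow> real"
  where "range t \<subseteq> T" "strict_mono t" "\<not> bdd_above (range t)"
    "T \<inter> {..<t 0} = {}" "\<And>k. T \<inter> {t k<..<t (Suc k)} = {}"
proof -
  have least: "\<exists>s. s \<in> T \<and> P s \<and> T \<inter> {r. P r \<and> r < s} = {}" if "s\<^sub>0 \<in> T" "P s\<^sub>0" for P s\<^sub>0
  proof -
    let ?A = "{r \<in> T \<inter> {..s\<^sub>0}. P r}"
    have A: "finite ?A" "?A \<noteq> {}" using fin[of s\<^sub>0] that by (auto intro: rev_finite_subset)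
    have "Min ?A \<in> ?A" by (rule Min_in[OF A])
    moreover from this have "T \<inter> {r. P r \<and> r < Min ?A} = {}"
    proof -
      have "\<not> r < Min ?A" if "r \<in> T" "P r" for r
      proof (cases "r \<le> s\<^sub>0")
        case True
        with that have "Min ?A \<le> r" by (intro Min_le[OF A(1)]) simp
        then show ?thesis by simp
      next
        case False
        with \<open>Min ?A \<in> ?A\<close> show ?thesis by auto
      qed
      then show ?thesis by blast
    qed
    ultimately show ?thesis by blast
  qed
  obtain s where s: "s \<in> T" "T \<inter> {..<s} = {}"
    using least[of _ "\<lambda>_. True"] \<open>T \<noteq> {}\<close> by (auto simp: lessThan_def)
  have step: "\<exists>r. r \<in> T \<and> a < r \<and> T \<inter> {a<..<r} = {}" for a
  proof -
    obtain s\<^sub>0 where "s\<^sub>0 \<in> T" "a < s\<^sub>0"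
      using \<open>\<not> bdd_above T\<close> by (auto simp: bdd_above_def not_le)
    from least[of s\<^sub>0 "\<lambda>r. a < r", OF this] show ?thesis
      by (auto simp: greaterThanLessThan_def greaterThan_def lessThan_def)
  qed
  \<comment> \<open>The clause for \<open>k = 0\<close> is part of the invariant of the dependent
    choice; it forces the sequence to start at the least element \<open>s\<close>.\<close>
  have "\<exists>t. \<forall>k. (t k \<in> T \<and> (k = 0 \<longrightarrow> t k = s)) \<and> t k < t (Suc k) \<and> T \<inter> {t k<..<t (Suc k)} = {}"
    by (rule dependent_nat_choice) (use s step in auto)
  then obtain t where t: "t k \<in> T" "t k < t (Suc k)" "T \<inter> {t k<..<t (Suc k)} = {}"
    and "t 0 = s" for k by blast
  have mono: "strict_mono t" using t(2) by (rule strict_mono_Suc_iff[THEN iffD2, rule_format])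
  have "\<not> bdd_above (range t)"
  proof
    assume "bdd_above (range t)"
    then obtain b where "range t \<subseteq> T \<inter> {..b}" using t(1) by (auto simp: bdd_above_def)
    with fin have "finite (range t)" by (rule finite_subset[rotated])
    moreover have "inj t" using mono by (rule strict_mono_imp_inj_on)
    ultimately show False using finite_imageD by blast
  qed
  show thesis
  proof (rule that)
    show "range t \<subseteq> T" using t(1) by blast
    show "T \<inter> {..<t 0} = {}" using s(2) \<open>t 0 = s\<close> by simp
  qed fact+
qed

text \<open>\<open>T\<close> may contain points where \<open>x\<close> does not switch, and may be
  finite or empty, so such sets can be translated and united freely. The interval
  \<open>{a<..b}\<close> includes \<open>b\<close> and not \<open>a\<close> because a signal already
  has its new value at a switching time.\<close>

lemma signals_iff_switching_set:
  "x \<in> signals \<longleftrightarrow>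
    (\<exists>T\<subseteq>{0..}. (\<forall>a. finite (T \<inter> {..a})) \<and> (\<forall>a b. a < b \<and> T \<inter> {a<..b} = {} \<longrightarrow> x a = x b))"
  (is "_ \<longleftrightarrow> ?R")
proof
  assume "x \<in> signals"
  then obtain t :: "nat \<Rightarrow> real" where t: "0 \<le> t 0" "strict_mono t" "\<not> bdd_above (range t)"
    "x constant_on {..<t 0}" and const: "\<And>k. x constant_on {t k..<t (Suc k)}"
    by (auto simp: signals_def)
  have beyond: "\<exists>K. a < t K" for a using t(3) by (auto simp: bdd_above_def not_le)
  have "finite (range t \<inter> {..a})" for a
  proof -
    obtain K where "a < t K" using beyond by blast
    then have "range t \<inter> {..a} \<subseteq> t ` {..K}"
      using t(2)
      by (auto simp: strict_mono_less)
        (metis atMost_iff image_eqI le_less_trans less_imp_le strict_mono_less)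
    then show ?thesis by (rule finite_subset) simp
  qed
  moreover have "x a = x b" if ab: "a < b" "range t \<inter> {a<..b} = {}" for a b
  proof (cases "b < t 0")
    case True
    with t(4) ab(1) show ?thesis by (auto simp: constant_on_def)
  next
    case False
    \<comment> \<open>The predecessor \<open>k\<close> of \<open>?K\<close> satisfies
      \<open>t k \<le> b < t (Suc k)\<close>. No switching time lies in \<open>{a<..b}\<close>, so
      even \<open>t k \<le> a\<close>, and \<open>a\<close> and \<open>b\<close> share an interval
      of constancy.\<close>
    let ?K = "LEAST K. b < t K"
    have K: "b < t ?K" using beyond by (rule LeastI_ex)
    with False obtain k where k: "?K = Suc k" by (cases ?K) auto
    have "t k \<le> b" using not_less_Least[of k "\<lambda>K. b < t K"] k by auto
    have "t k \<notin> {a<..b}" using ab(2) by blast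
    with \<open>t k \<le> b\<close> have "t k \<le> a" by auto
    with ab K \<open>t k \<le> b\<close> const[of k] k show ?thesis by (auto simp: constant_on_def)
  qed
  moreover have "range t \<subseteq> {0..}"
    using t(1,2) by (auto intro: order_trans simp: strict_mono_less_eq)
  ultimately show ?R by blast
next
  assume ?R
  then obtain T where T: "T \<subseteq> {0..}" "\<And>a. finite (T \<inter> {..a})"
    and eq: "\<And>a b. a < b \<Longrightarrow> T \<inter> {a<..b} = {} \<Longrightarrow> x a = x b" by blast
  \<comment> \<open>Adding the natural numbers makes the set unbounded.\<close>
  let ?T = "T \<union> range real"
  have "finite (range real \<inter> {..a})" for a
    by (rule finite_subset[of _ "real ` {..nat \<lfloor>a\<rfloor>}"]) (auto simp: le_nat_floor)
  then have fin: "finite (?T \<inter> {..a})" for a using T(2) by (simp add: Int_Un_distrib2)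
  have unb: "\<not> bdd_above ?T"
    by (auto simp: bdd_above_def not_le) (metis UnI2 rangeI reals_Archimedean2)
  obtain t :: "nat \<Rightarrow> real" where t: "range t \<subseteq> ?T" "strict_mono t" "\<not> bdd_above (range t)"
    "?T \<inter> {..<t 0} = {}" "\<And>k. ?T \<inter> {t k<..<t (Suc k)} = {}"
    using locally_finite_enumeration[OF _ unb fin] by blast
  have const: "x constant_on A"
    if free: "\<And>a b. a \<in> A \<Longrightarrow> b \<in> A \<Longrightarrow> a < b \<Longrightarrow> T \<inter> {a<..b} = {}" for A
  proof -
    have "x a = x b" if "a \<in> A" "b \<in> A" for a b
      using that free eq by (metis linorder_neqE_linordered_idom)
    then show ?thesis unfolding constant_on_def by blast
  qed
  have "0 \<le> t 0" using t(1) T(1) by fastforce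
  moreover have "x constant_on {..<t 0}" by (rule const) (use t(4) in fastforce)
  moreover have "x constant_on {t k..<t (Suc k)}" for k by (rule const) (use t(5)[of k] in fastforce)
  ultimately show "x \<in> signals" using t(2,3) by (auto simp: signals_def)
qed

text \<open>\<open>left_limit\<close> is a definite description, usable only after existence and
  uniqueness. Existence holds since \<open>x\<close> is constant on a short interval that ends at
  \<open>t\<close> and avoids \<open>T\<close>.\<close>

lemma signal_left_limit:
  assumes "x \<in> signals"
  obtains \<epsilon> where "0 < \<epsilon>" "\<And>s. t - \<epsilon> < s \<Longrightarrow> s < t \<Longrightarrow> x s = left_limit x t"
proof -
  obtain T where T: "\<And>a. finite (T \<inter> {..a})"
    and eq: "\<And>a b. a < b \<Longrightarrow> T \<inter> {a<..b} = {} \<Longrightarrow> x a = x b"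
    using assms unfolding signals_iff_switching_set by blast
  let ?P = "\<lambda>b. \<exists>\<epsilon>>0. \<forall>\<xi>\<in>{t - \<epsilon><..<t}. x \<xi> = b"
  \<comment> \<open>The extra point \<open>t - 1\<close> keeps the set nonempty, so that
    \<open>Max\<close> is meaningful even if no point of \<open>T\<close> precedes
    \<open>t\<close>.\<close>
  let ?A = "insert (t - 1) (T \<inter> {..<t})"
  have "T \<inter> {..<t} \<subseteq> T \<inter> {..t}" by auto
  then have "finite (T \<inter> {..<t})" using T by (rule finite_subset)
  then have fin: "finite ?A" by simp
  define r where "r = Max ?A"
  have "r \<in> ?A" unfolding r_def using fin by (intro Max_in) auto
  then have "r < t" by auto
  have r: "s \<le> r" if "s \<in> T" "s < t" for s using that fin by (auto simp: r_def)
  define c where "c = (r + t) / 2"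
  have c: "r < c" "c < t" using \<open>r < t\<close> by (auto simp: c_def)
  have same: "x a = x b" if "r < a" "a < b" "b < t" for a b
    using that r by (intro eq) force+
  have "x s = x c" if "r < s" "s < t" for s
    using same[OF that(1) _ c(2)] same[OF c(1) _ that(2)] by (metis linorder_neqE)
  then have ex: "?P (x c)" using \<open>r < t\<close> by (intro exI[of _ "t - r"]) auto
  have unique: "b = b'" if bb: "?P b" "?P b'" for b b'
  proof -
    from bb obtain e e' where e: "0 < e" "\<forall>\<xi>\<in>{t - e<..<t}. x \<xi> = b"
      and e': "0 < e'" "\<forall>\<xi>\<in>{t - e'<..<t}. x \<xi> = b'" by blast
    have "t - min e e' / 2 \<in> {t - e<..<t} \<inter> {t - e'<..<t}" using e(1) e'(1) by (auto simp: min_def)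
    with e(2) e'(2) show ?thesis by blast
  qed
  have "?P (left_limit x t)"
    unfolding left_limit_def by (rule theI'[OF ex1I[of ?P, OF ex unique[OF _ ex]]])
  then obtain \<epsilon> where "0 < \<epsilon>" "\<forall>\<xi>\<in>{t - \<epsilon><..<t}. x \<xi> = left_limit x t" by blast
  then show thesis by (intro that[of \<epsilon>]) simp_all
qed

text \<open>Both maps have the form \<open>F (u\<close> followed by the image of this window, with
  \<open>F\<close> being \<open>Inf\<close> or \<open>Sup\<close>; all properties but constancy can
  thus be shown for both at once.\<close>

definition window :: "real \<Rightarrow> real \<Rightarrow> real \<Rightarrow> real set" where
  "window m d t = {t - d..t - d + m}"

lemma window_image_signal:
  assumes "0 \<le> m" "m \<le> d" "u \<in> signals"
  shows "(\<lambda>t. F (u ` window m d t)) \<in> signals"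
proof -
  obtain T where T: "T \<subseteq> {0..}" "\<And>a. finite (T \<inter> {..a})"
    and eq: "\<And>a b. a < b \<Longrightarrow> T \<inter> {a<..b} = {} \<Longrightarrow> u a = u b"
    using assms(3) by (auto simp: signals_iff_switching_set)
  \<comment> \<open>A switching time \<open>s\<close> meets the left end of the window at time
    \<open>s + d\<close> and the right end at \<open>s + (d - m)\<close>. Both shifts are
    nonnegative, which keeps \<open>T'\<close> in \<open>{0..}\<close>.\<close>
  define T' where "T' = (\<lambda>s. s + d) ` T \<union> (\<lambda>s. s + (d - m)) ` T"
  have "finite ((\<lambda>s. s + c) ` T \<inter> {..a})" for a c
    by (rule finite_subset[of _ "(\<lambda>s. s + c) ` (T \<inter> {..a - c})"]) (use T(2) in auto)
  then have "finite (T' \<inter> {..a})" for a by (simp add: T'_def Int_Un_distrib2)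
  moreover have "T' \<subseteq> {0..}" using T(1) assms(1,2) by (force simp: T'_def)
  moreover have "u ` window m d a = u ` window m d b" if ab: "a < b" "T' \<inter> {a<..b} = {}" for a b
  proof -
    have free: "s \<notin> {a - d<..b - d}" "s \<notin> {a - d + m<..b - d + m}" if "s \<in> T" for s
      using ab(2) that by (force simp: T'_def disjoint_iff algebra_simps)+
    \<comment> \<open>A point lost on the left lies in \<open>{a - d..<b - d}\<close> and has the
      value at the left end of the later window.\<close>
    have "u s \<in> u ` window m d b" if s: "s \<in> window m d a" for s
    proof (cases "b - d \<le> s")
      case True
      with s ab(1) show ?thesis by (auto simp: window_def)
    next
      case False
      then have "u s = u (b - d)" using s free by (intro eq) (force simp: window_def)+
      then show ?thesis using assms(1) by (auto simp: window_def)
    qed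
    \<comment> \<open>A point gained on the right has the value at the right end of the earlier
      window.\<close>
    moreover have "u s \<in> u ` window m d a" if s: "s \<in> window m d b" for s
    proof (cases "s \<le> a - d + m")
      case True
      with s ab(1) show ?thesis by (auto simp: window_def)
    next
      case False
      then have "u (a - d + m) = u s" using s free by (intro eq) (force simp: window_def)+
      moreover have "a - d + m \<in> window m d a" using assms(1) by (auto simp: window_def)
      ultimately show ?thesis by (rule image_eqI[OF sym])
    qed
    ultimately show ?thesis by blast
  qed
  ultimately show ?thesis
    unfolding signals_iff_switching_set by (intro exI[of _ T']) auto
qed

text \<open>Once \<open>t - d\<close> has passed the time after which \<open>u\<close> is constantly
  \<open>a\<close>, the whole window has image \<open>{a}\<close>.\<close>

lemma window_image_stable:
  assumes "0 \<le> m" and F: "\<And>a. F {a} = a"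
  shows "stability_condition u (\<lambda>t. F (u ` window m d t))"
  unfolding stability_condition_def
proof (intro allI impI)
  fix a assume "\<forall>\<^sub>F t in at_top. u t = a"
  then obtain N where N: "\<And>t. N \<le> t \<Longrightarrow> u t = a" by (auto simp: eventually_at_top_linorder)
  have "F (u ` window m d t) = a" if "N + d \<le> t" for t
  proof -
    have "t - d \<in> window m d t" using assms(1) by (auto simp: window_def)
    moreover have "u s = a" if "s \<in> window m d t" for s
      using that \<open>N + d \<le> t\<close> by (intro N) (auto simp: window_def)
    ultimately have "u ` window m d t = {a}" by force
    then show ?thesis by (simp add: F)
  qed
  then show "\<forall>\<^sub>F t in at_top. F (u ` window m d t) = a"
    unfolding eventually_at_top_linorder by blast
qed

lemma window_image_delay:
  assumes "0 \<le> m" "m \<le> d" and F: "\<And>a. F {a} = a"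
    and i: "\<And>u. i u = {\<lambda>t. F (u ` window m d t)}"
  shows "delay_condition i" "deterministic i" "time_invariant i"
proof -
  note sig = window_image_signal[OF assms(1,2)]
  show "delay_condition i"
    using sig window_image_stable[of m F, OF assms(1) F]
    by (auto simp: delay_condition_def Sol_SC_def i)
  show "deterministic i" by (auto simp: deterministic_def i)
  have "(\<lambda>t. F (u ` window m d t)) \<circ> shift c = (\<lambda>t. F ((u \<circ> shift c) ` window m d t))" for u c
  proof
    fix t
    \<comment> \<open>Windows move with time, so delaying the output by \<open>c\<close> amounts to
      delaying the input by \<open>c\<close>.\<close>
    have "window m d (t - c) = shift c ` window m d t"
      by (auto simp: window_def shift_def image_iff intro!: bexI[of _ "_ + c"])
    then show "((\<lambda>t. F (u ` window m d t)) \<circ> shift c) t = F ((u \<circ> shift c) ` window m d t)"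
      by (simp add: shift_def image_comp)
  qed
  then show "time_invariant i"
    unfolding time_invariant_def i using sig by (metis singletonD singletonI)
qed

text \<open>The window at \<open>r\<close> contains \<open>s\<close> exactly for
  \<open>s + d - m \<le> r \<le> s + d\<close>. If \<open>s\<close> is not the right end at
  \<open>t\<close>, this range of times begins strictly before \<open>t\<close>, so it meets every
  interval just before \<open>t\<close>.\<close>

lemma window_left_limit:
  assumes "x \<in> signals" "s \<in> window m d t" "s \<noteq> t - d + m"
  obtains r where "s \<in> window m d r" "x r = left_limit x t"
proof -
  obtain \<epsilon> where \<epsilon>: "0 < \<epsilon>" "\<And>r. t - \<epsilon> < r \<Longrightarrow> r < t \<Longrightarrow> x r = left_limit x t"
    using signal_left_limit[OF assms(1)] by blast
  let ?r = "max (t - \<epsilon> / 2) (s + d - m)"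
  have "s \<in> window m d ?r" "t - \<epsilon> < ?r" "?r < t"
    using assms(2,3) \<epsilon>(1) by (auto simp: window_def max_def)
  with \<epsilon>(2) that show thesis by blast
qed

lemma constant_delay_Inf:
  assumes "0 \<le> m" "m \<le> d"
  shows "constant_delay (delay_Inf m d)"
  unfolding constant_delay_def
proof (intro exI conjI ballI allI)
  \<comment> \<open>The order of these facts fixes the witnesses: the rise delay is
    \<open>d\<close>, the fall delay \<open>d - m\<close>.\<close>
  show "0 \<le> d" "0 \<le> d - m" using assms by auto
  fix u x t assume u: "u \<in> signals" and "x \<in> delay_Inf m d u"
  then have x: "x = (\<lambda>t. Inf (u ` window m d t))" by (simp add: delay_Inf_def window_def)
  have xs: "x \<in> signals" unfolding x using window_image_signal[OF assms u] .
  show "(\<not> left_limit x t \<and> x t) \<le> u (t - d)"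
    using assms(1) by (auto simp: x window_def)
  show "(left_limit x t \<and> \<not> x t) \<le> (\<not> u (t - (d - m)))"
  proof (intro le_boolI)
    assume lim: "left_limit x t \<and> \<not> x t"
    then obtain s where s: "s \<in> window m d t" "\<not> u s" by (auto simp: x)
    have "s = t - d + m"
    proof (rule ccontr)
      assume "s \<noteq> t - d + m"
      \<comment> \<open>Otherwise an earlier window with output \<open>1\<close> would already
        contain the zero \<open>s\<close> of \<open>u\<close>.\<close>
      with window_left_limit[OF xs s(1)] lim obtain r where "s \<in> window m d r" "x r" by metis
      with s(2) show False by (auto simp: x)
    qed
    with s(2) show "\<not> u (t - (d - m))" by (simp add: algebra_simps)
  qed
qed

lemma constant_delay_Sup:
  assumes "0 \<le> m" "m \<le> d"
  shows "constant_delay (delay_Sup m d)"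
  unfolding constant_delay_def
proof (intro exI conjI ballI allI)
  \<comment> \<open>Here the rise delay is \<open>d - m\<close> and the fall delay
    \<open>d\<close>.\<close>
  show "0 \<le> d - m" "0 \<le> d" using assms by auto
  fix u x t assume u: "u \<in> signals" and "x \<in> delay_Sup m d u"
  then have x: "x = (\<lambda>t. Sup (u ` window m d t))" by (simp add: delay_Sup_def window_def)
  have xs: "x \<in> signals" unfolding x using window_image_signal[OF assms u] .
  show "(left_limit x t \<and> \<not> x t) \<le> (\<not> u (t - d))"
    using assms(1) by (auto simp: x window_def)
  show "(\<not> left_limit x t \<and> x t) \<le> u (t - (d - m))"
  proof (intro le_boolI)
    assume lim: "\<not> left_limit x t \<and> x t"
    then obtain s where s: "s \<in> window m d t" "u s" by (auto simp: x)
    have "s = t - d + m"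
    proof (rule ccontr)
      assume "s \<noteq> t - d + m"
      with window_left_limit[OF xs s(1)] lim obtain r where "s \<in> window m d r" "\<not> x r" by metis
      with s(2) show False by (auto simp: x)
    qed
    with s(2) show "u (t - (d - m))" by (simp add: algebra_simps)
  qed
qed

theorem theorem8p3:
  fixes m d :: real
  assumes "0 \<le> m" and "m \<le> d"
  shows "delay_condition (delay_Inf m d) \<and> deterministic (delay_Inf m d) \<and>
         time_invariant (delay_Inf m d) \<and> constant_delay (delay_Inf m d) \<and>
         delay_condition (delay_Sup m d) \<and> deterministic (delay_Sup m d) \<and>
         time_invariant (delay_Sup m d) \<and> constant_delay (delay_Sup m d)"
proof -
  have "delay_Inf m d u = {\<lambda>t. Inf (u ` window m d t)}" for u
    by (simp add: delay_Inf_def window_def)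
  note Inf = window_image_delay[OF assms _ this]
  have "delay_Sup m d u = {\<lambda>t. Sup (u ` window m d t)}" for u
    by (simp add: delay_Sup_def window_def)
  note Sup = window_image_delay[OF assms _ this]
  show ?thesis
    using Inf Sup constant_delay_Inf[OF assms] constant_delay_Sup[OF assms] by simp
qed

end
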